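(* Let $\overline{G}$ be a geometric graph with underlying abstract graph $G$, in which any two distinct crossings are independent, and suppose $\chi(G)\in\{2,3\}$. Then $X(\overline{G}) \leq 2\chi(G)$.
   Context: Graphs are finite and simple. A geometric graph $\overline{G}$ is a simple graph $G$ drawn in the plane with vertices at distinct points in general position (no three collinear) and edges drawn as straight line segments. Two edges with no common endpoint cross if their segments intersect; a crossing of $\overline{G}$ is a pair of edges that cross, and the vertices of a crossing are the four endpoints of its two edges. Two crossings are independent if they have no vertices in common (equivalently, the minimum graph distance between a vertex of one and a vertex of the other is at least $1$). A geometric homomorphism $f:\overline{G}\to\overline{H}$ between geometric graphs is a map of vertex sets that sends adjacent vertices to adjacent vertices and sends each pair of crossing edges of $\overline{G}$ to a pair of crossing edges of $\overline{H}$. A geometric $n$-clique $\overline{K}_n$ is any geometric graph whose underlying abstract graph is the complete graph $K_n$. The geochromatic number $X(\overline{G})$ is the smallest positive integer $n$ such that there is a geometric homomorphism $\overline{G}\to\overline{K}_n$ for some geometric $n$-clique $\overline{K}_n$. $\chi(G)$ is the ordinary chromatic number of $G$. *)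

theory Defs
  imports "HOL-Analysis.Analysis"
begin

record 'a ugraph =
  verts :: "'a set"
  edges :: "'a set set"

definition simple_graph :: "('a, 'z) ugraph_scheme \<Rightarrow> bool" where
  "simple_graph G \<longleftrightarrow>
     finite (verts G) \<and> (\<forall>e\<in>edges G. e \<subseteq> verts G \<and> card e = 2)"

definition proper_colouring :: "('a, 'z) ugraph_scheme \<Rightarrow> nat \<Rightarrow> ('a \<Rightarrow> nat) \<Rightarrow> bool" where
  "proper_colouring G k c \<longleftrightarrow>
     c ` verts G \<subseteq> {..<k} \<and> (\<forall>u v. {u, v} \<in> edges G \<longrightarrow> c u \<noteq> c v)"

definition chromatic_number :: "('a, 'z) ugraph_scheme \<Rightarrow> nat" where
  "chromatic_number G = (LEAST k. \<exists>c. proper_colouring G k c)"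

(* The edges of the drawing are determined by the positions of their endpoints;
   the values of pos outside verts are irrelevant. *)
record 'a geom_graph = "'a ugraph" +
  pos :: "'a \<Rightarrow> real^2"

definition geometric_graph :: "'a geom_graph \<Rightarrow> bool" where
  "geometric_graph G \<longleftrightarrow>
     simple_graph G \<and> inj_on (pos G) (verts G) \<and>
     (\<forall>x\<in>verts G. \<forall>y\<in>verts G. \<forall>z\<in>verts G.
        x \<noteq> y \<and> y \<noteq> z \<and> x \<noteq> z \<longrightarrow> \<not> collinear {pos G x, pos G y, pos G z})"

(* For an edge {u, v} this is the closed segment from pos G u to pos G v. *)
definition edge_segment :: "'a geom_graph \<Rightarrow> 'a set \<Rightarrow> (real^2) set" where
  "edge_segment G e = convex hull (pos G ` e)"

definition edges_cross :: "'a geom_graph \<Rightarrow> 'a set \<Rightarrow> 'a set \<Rightarrow> bool" where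
  "edges_cross G e e' \<longleftrightarrow>
     e \<in> edges G \<and> e' \<in> edges G \<and> e \<inter> e' = {} \<and>
     edge_segment G e \<inter> edge_segment G e' \<noteq> {}"

definition crossings :: "'a geom_graph \<Rightarrow> 'a set set set" where
  "crossings G = {{e, e'} | e e'. edges_cross G e e'}"

(* The union of a crossing is the set of the four endpoints of its two edges. *)
definition independent_crossings :: "'a set set \<Rightarrow> 'a set set \<Rightarrow> bool" where
  "independent_crossings X Y \<longleftrightarrow> \<Union>X \<inter> \<Union>Y = {}"

definition geometric_hom :: "'a geom_graph \<Rightarrow> 'b geom_graph \<Rightarrow> ('a \<Rightarrow> 'b) \<Rightarrow> bool" where
  "geometric_hom G H f \<longleftrightarrow>
     f ` verts G \<subseteq> verts H \<and>
     (\<forall>u v. {u, v} \<in> edges G \<longrightarrow> {f u, f v} \<in> edges H) \<and>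
     (\<forall>e e'. edges_cross G e e' \<longrightarrow> edges_cross H (f ` e) (f ` e'))"

definition geometric_clique :: "nat \<Rightarrow> 'a geom_graph \<Rightarrow> bool" where
  "geometric_clique n H \<longleftrightarrow>
     geometric_graph H \<and> card (verts H) = n \<and>
     edges H = {e. e \<subseteq> verts H \<and> card e = 2}"

(* Taking nat as the vertex type of the clique loses no generality: the clique is
   finite, so its vertices can be renamed without moving their positions. *)
definition geochromatic_number :: "'a geom_graph \<Rightarrow> nat" where
  "geochromatic_number G =
     (LEAST n. 0 < n \<and> (\<exists>(H :: nat geom_graph) f. geometric_clique n H \<and> geometric_hom G H f))"

end

theory Submission
  imports Defs
begin

text \<open>
  Write \<open>n\<close> for the chromatic number of \<open>G\<close>, fix a proper colouring \<open>c\<close> with colours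
  \<open>0, \<dots>, n - 1\<close>, and let the target be a clique on \<open>2 * n\<close> points in convex position, numbered
  consecutively, where colour \<open>i\<close> owns the two neighbouring points \<open>2 * i\<close> and \<open>2 * i + 1\<close>.
  Any map that sends each vertex of colour \<open>i\<close> to one of the two points of colour \<open>i\<close> preserves
  adjacency, so only the choice between the two points matters, and it is made crossing by crossing:
  all vertices of one edge of the crossing take the lower point of their colour, all vertices of
  the other edge the upper point.  These choices never conflict, because distinct crossings
  share no vertex.

  In convex position two chords cross if their endpoints alternate.  Let the colours on two
  crossing edges be \<open>i < j\<close> and \<open>k < l\<close>.  If the intervals \<open>{i..j}\<close> and \<open>{k..l}\<close> meet and neither
  lies strictly between the endpoints of the other, then the images alternate for a suitable
  choice of the upper edge: in the case \<open>i \<le> k < j \<le> l\<close> it is the second one, since then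
  \<open>2 * i < 2 * k + 1 < 2 * j < 2 * l + 1\<close>.  With at most three colours the two intervals are always
  in such a position (\<open>two_or_three_colours_interleave\<close>).  With four colours this breaks down for
  the pairs \<open>0, 1\<close> and \<open>2, 3\<close>.

  Points on the parabola \<open>y = x\<^sup>2\<close> serve as points in convex position
  (\<open>geometric_clique_parabola_clique\<close>, \<open>interleaved_chords_cross\<close>).
\<close>

section \<open>Cliques in convex position\<close>

definition parabola_point :: "real \<Rightarrow> real^2" where
  "parabola_point t = vector [t, t\<^sup>2]"

definition parabola_clique :: "nat \<Rightarrow> nat geom_graph" where
  "parabola_clique m =
     \<lparr>verts = {..<m}, edges = {e. e \<subseteq> {..<m} \<and> card e = 2}, pos = (\<lambda>i. parabola_point (real i))\<rparr>"

definition interleaved :: "nat set \<Rightarrow> nat set \<Rightarrow> bool" where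
  "interleaved d d' \<longleftrightarrow>
     (\<exists>x z y w. x < z \<and> z < y \<and> y < w \<and>
        (d = {x, y} \<and> d' = {z, w} \<or> d' = {x, y} \<and> d = {z, w}))"

lemma interleaved_commute: "interleaved d d' \<longleftrightarrow> interleaved d' d"
  unfolding interleaved_def by blast

lemma parabola_point_nth [simp]:
  "parabola_point t $ 1 = t" "parabola_point t $ 2 = t\<^sup>2"
  by (simp_all add: parabola_point_def)

lemma parabola_point_inject [simp]: "parabola_point s = parabola_point t \<longleftrightarrow> s = t"
  by (metis parabola_point_nth(1))

lemma parabola_points_not_collinear:
  assumes "r \<noteq> s" "s \<noteq> t" "r \<noteq> t"
  shows "\<not> collinear {parabola_point r, parabola_point s, parabola_point t}"
proof
  assume "collinear {parabola_point r, parabola_point s, parabola_point t}"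
  then obtain u where
    "parabola_point s = u *\<^sub>R parabola_point r + (1 - u) *\<^sub>R parabola_point t"
    using assms by (auto simp: collinear_3_expand)
  from arg_cong[where f = "\<lambda>v. v $ 1", OF this] arg_cong[where f = "\<lambda>v. v $ 2", OF this]
  have s: "s = u * r + (1 - u) * t" "s\<^sup>2 = u * r\<^sup>2 + (1 - u) * t\<^sup>2"
    by simp_all
  \<comment> \<open>The gap between a chord of the parabola and the arc below it, at the parameter \<open>u\<close>.\<close>
  have "u * (1 - u) * (r - t)\<^sup>2 = u * r\<^sup>2 + (1 - u) * t\<^sup>2 - (u * r + (1 - u) * t)\<^sup>2"
    by (simp add: power2_eq_square algebra_simps)
  also have "\<dots> = 0"
    using s by simp
  finally have "u = 0 \<or> u = 1"
    using \<open>r \<noteq> t\<close> by auto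
  then show False
    using s(1) assms by auto
qed

lemma geometric_clique_parabola_clique: "geometric_clique m (parabola_clique m)"
  unfolding geometric_clique_def geometric_graph_def simple_graph_def
  by (auto simp: parabola_clique_def inj_on_def parabola_points_not_collinear)

lemma closed_segment_parabola_point:
  assumes "a \<le> t" "t \<le> b" "a < b"
  shows "vector [t, (a + b) * t - a * b] \<in> closed_segment (parabola_point a) (parabola_point b)"
proof -
  define u where "u = (t - a) / (b - a)"
  have u: "0 \<le> u" "u \<le> 1" and t: "t = (1 - u) * a + u * b"
    using assms by (simp_all add: u_def divide_simps) (simp add: algebra_simps)
  have "(a + b) * t - a * b = (1 - u) * a\<^sup>2 + u * b\<^sup>2"
    unfolding t by (simp add: power2_eq_square algebra_simps)
  with t have "vector [t, (a + b) * t - a * b] = (1 - u) *\<^sub>R parabola_point a + u *\<^sub>R parabola_point b"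
    by (simp add: vec_eq_iff forall_2)
  with u show ?thesis
    unfolding closed_segment_def by blast
qed

lemma parabola_chords_meet:
  assumes "x < z" "z < y" "y < w"
  shows "closed_segment (parabola_point x) (parabola_point y) \<inter>
         closed_segment (parabola_point z) (parabola_point w) \<noteq> {}"
proof -
  \<comment> \<open>The first coordinate at which the two lines through the chords agree.\<close>
  define t where "t = (z * w - x * y) / ((z + w) - (x + y))"
  have D: "(z + w) - (x + y) > 0"
    using assms by simp
  have "t - z = (z - x) * (y - z) / ((z + w) - (x + y))"
    using D by (simp add: t_def field_simps)
  also have "\<dots> \<ge> 0"
    using D assms by (intro divide_nonneg_pos mult_nonneg_nonneg) auto
  finally have "z \<le> t"
    by simp
  have "y - t = (y - z) * (w - y) / ((z + w) - (x + y))"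
    using D by (simp add: t_def field_simps)
  also have "\<dots> \<ge> 0"
    using D assms by (intro divide_nonneg_pos mult_nonneg_nonneg) auto
  finally have "t \<le> y"
    by simp
  have "(x + y) * t - x * y = (z + w) * t - z * w"
    using D by (simp add: t_def field_simps)
  then show ?thesis
    using closed_segment_parabola_point[of x t y] closed_segment_parabola_point[of z t w]
      \<open>z \<le> t\<close> \<open>t \<le> y\<close> assms by fastforce
qed

lemma interleaved_chords_cross:
  assumes "interleaved d d'" "d \<subseteq> {..<m}" "d' \<subseteq> {..<m}"
  shows "edges_cross (parabola_clique m) d d'"
proof -
  obtain x z y w where o: "x < z" "z < y" "y < w"
    and d: "d = {x, y} \<and> d' = {z, w} \<or> d' = {x, y} \<and> d = {z, w}"
    using assms(1) unfolding interleaved_def by blast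
  have "closed_segment (parabola_point (real x)) (parabola_point (real y)) \<inter>
        closed_segment (parabola_point (real z)) (parabola_point (real w)) \<noteq> {}"
    using o by (intro parabola_chords_meet) auto
  with o d assms(2,3) show ?thesis
    unfolding edges_cross_def
    by (auto simp: parabola_clique_def edge_segment_def segment_convex_hull)
qed

section \<open>Colourings and the choice of upper edges\<close>

text \<open>
  Let \<open>i < j\<close> and \<open>k < l\<close>.  Up to exchanging the two edges, the endpoints alternate in one of two
  ways: \<open>i \<le> k < j \<le> l\<close> when the second edge is the upper one, and \<open>i < k \<le> j < l\<close> when the first
  one is.  Two intervals in \<open>{0..2}\<close> with at least two elements each always share an element and
  are never strictly nested.
\<close>
lemma two_or_three_colours_interleave:
  fixes i j k l :: nat
  assumes "i \<noteq> j" "k \<noteq> l" "i < 3" "j < 3" "k < 3" "l < 3"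
  shows "interleaved {2 * i, 2 * j} {2 * k + 1, 2 * l + 1} \<or>
         interleaved {2 * k, 2 * l} {2 * i + 1, 2 * j + 1}"
proof -
  have *: "interleaved {2 * i, 2 * j} {2 * k + 1, 2 * l + 1} \<or>
           interleaved {2 * k, 2 * l} {2 * i + 1, 2 * j + 1}"
    if ord: "i < j" "k < l" "j < 3" "l < 3" for i j k l :: nat
  proof -
    consider "i \<le> k" "k < j" "j \<le> l" | "k < i" "i \<le> l" "l < j"
      | "k \<le> i" "i < l" "l \<le> j" | "i < k" "k \<le> j" "j < l"
      using ord by linarith
    then show ?thesis
    proof cases
      case 1
      then have "2 * i < 2 * k + 1" "2 * k + 1 < 2 * j" "2 * j < 2 * l + 1" by auto
      then show ?thesis unfolding interleaved_def by blast
    next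
      case 2
      then have "2 * k + 1 < 2 * i" "2 * i < 2 * l + 1" "2 * l + 1 < 2 * j" by auto
      then show ?thesis unfolding interleaved_def by blast
    next
      case 3
      then have "2 * k < 2 * i + 1" "2 * i + 1 < 2 * l" "2 * l < 2 * j + 1" by auto
      then show ?thesis unfolding interleaved_def by blast
    next
      case 4
      then have "2 * i + 1 < 2 * k" "2 * k < 2 * j + 1" "2 * j + 1 < 2 * l" by auto
      then show ?thesis unfolding interleaved_def by blast
    qed
  qed
  consider "i < j" "k < l" | "j < i" "k < l" | "i < j" "l < k" | "j < i" "l < k"
    using assms by linarith
  then show ?thesis
    using *[of i j k l] *[of j i k l] *[of i j l k] *[of j i l k] assms
    by cases (simp_all add: insert_commute)
qed

text \<open>
  An injective numbering of the vertices is a proper colouring, so the minimum that defines the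
  chromatic number is attained.
\<close>
lemma proper_colouring_chromatic_number:
  assumes "simple_graph G"
  obtains c where "proper_colouring G (chromatic_number G) c"
proof -
  obtain c :: "'a \<Rightarrow> nat" where c: "c ` verts G = {i. i < card (verts G)}" "inj_on c (verts G)"
    using assms finite_imp_inj_to_nat_seg[of "verts G"]
    unfolding simple_graph_def by (metis card_Collect_less_nat card_image)
  have "c u \<noteq> c v" if "{u, v} \<in> edges G" for u v
  proof -
    have "{u, v} \<subseteq> verts G" "card {u, v} = 2"
      using assms that unfolding simple_graph_def by auto
    with c(2) show ?thesis
      by (auto simp: inj_on_def card_2_iff)
  qed
  with c(1) have "proper_colouring G (card (verts G)) c"
    unfolding proper_colouring_def by auto
  then have "\<exists>c. proper_colouring G (chromatic_number G) c"
    unfolding chromatic_number_def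
    using LeastI_ex[of "\<lambda>k. \<exists>c. proper_colouring G k c"] by blast
  with that show ?thesis
    by blast
qed

text \<open>
  Local choices of a lower edge \<open>lo X\<close> and an upper edge \<open>hi X\<close> for each crossing \<open>X\<close> fit together:
  \<open>lo X\<close> is disjoint from \<open>hi X\<close> because crossing edges have no common endpoint, and from every other
  \<open>hi Y\<close> by independence.  The set \<open>U\<close> is the union of all upper edges.
\<close>
lemma independent_crossings_orient:
  assumes indep: "pairwise independent_crossings (crossings G)"
    and P: "\<And>e e'. edges_cross G e e' \<Longrightarrow> P e e' \<or> P e' e"
  obtains U where "\<And>e e'. edges_cross G e e' \<Longrightarrow>
    (e \<inter> U = {} \<and> e' \<subseteq> U \<and> P e e') \<or> (e' \<inter> U = {} \<and> e \<subseteq> U \<and> P e' e)"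
proof -
  have "\<forall>X\<in>crossings G. \<exists>e e'. X = {e, e'} \<and> e \<inter> e' = {} \<and> P e e'"
  proof
    fix X assume "X \<in> crossings G"
    then obtain e e' where e: "X = {e, e'}" "edges_cross G e e'"
      unfolding crossings_def by blast
    then have "e \<inter> e' = {}"
      unfolding edges_cross_def by blast
    with P[OF e(2)] e(1) show "\<exists>e e'. X = {e, e'} \<and> e \<inter> e' = {} \<and> P e e'"
      by (metis Int_commute insert_commute)
  qed
  then obtain lo hi where
    X: "\<And>X. X \<in> crossings G \<Longrightarrow> X = {lo X, hi X}"
    and disjoint: "\<And>X. X \<in> crossings G \<Longrightarrow> lo X \<inter> hi X = {}"
    and P_lo_hi: "\<And>X. X \<in> crossings G \<Longrightarrow> P (lo X) (hi X)"
    by metis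
  define U where "U = \<Union> (hi ` crossings G)"
  have lo: "lo X \<inter> U = {}" if "X \<in> crossings G" for X
  proof (rule ccontr)
    assume "lo X \<inter> U \<noteq> {}"
    then obtain v Y where v: "v \<in> lo X" "v \<in> hi Y" "Y \<in> crossings G"
      unfolding U_def by blast
    have "lo X \<in> X" "hi Y \<in> Y"
      using X[OF that] X[OF v(3)] by (metis insertI1, metis insertI1 insertI2)
    with v(1,2) have "v \<in> \<Union>X" "v \<in> \<Union>Y"
      by blast+
    then have "X = Y"
      using indep that v(3) unfolding pairwise_def independent_crossings_def by blast
    with v disjoint[OF that] show False
      by blast
  qed
  show ?thesis
  proof (rule that)
    fix e e' assume "edges_cross G e e'"
    then have C: "{e, e'} \<in> crossings G"
      unfolding crossings_def by blast
    obtain l h where l: "l = lo {e, e'}" and h: "h = hi {e, e'}"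
      by blast
    have "{e, e'} = {l, h}" "P l h"
      using X[OF C] P_lo_hi[OF C] unfolding l h .
    moreover have "l \<inter> U = {}"
      using lo[OF C] unfolding l .
    moreover have "h \<subseteq> U"
      using C unfolding h U_def by blast
    ultimately show "(e \<inter> U = {} \<and> e' \<subseteq> U \<and> P e e') \<or> (e' \<inter> U = {} \<and> e \<subseteq> U \<and> P e' e)"
      by (auto simp: doubleton_eq_iff)
  qed
qed

section \<open>The geometric homomorphism\<close>

lemma geometric_hom_of_colouring:
  assumes G: "geometric_graph G"
    and indep: "pairwise independent_crossings (crossings G)"
    and c: "proper_colouring G n c"
    and n: "n \<le> 3"
  shows "\<exists>f. geometric_hom G (parabola_clique (2 * n)) f"
proof -
  have edge: "e \<subseteq> verts G" "card e = 2" if "e \<in> edges G" for e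
    using G that unfolding geometric_graph_def simple_graph_def by auto
  have less: "c v < n" if "v \<in> verts G" for v
    using c that unfolding proper_colouring_def by auto
  have neq: "c u \<noteq> c v" if "{u, v} \<in> edges G" for u v
    using c that unfolding proper_colouring_def by auto
  define P where "P e e' \<longleftrightarrow> interleaved ((\<lambda>v. 2 * c v) ` e) ((\<lambda>v. 2 * c v + 1) ` e')" for e e'
  have "P e e' \<or> P e' e" if "edges_cross G e e'" for e e'
  proof -
    have e: "e \<in> edges G" "e' \<in> edges G"
      using that unfolding edges_cross_def by auto
    obtain p q where pq: "e = {p, q}"
      using edge(2)[OF e(1)] by (auto simp: card_2_iff)
    obtain r s where rs: "e' = {r, s}"
      using edge(2)[OF e(2)] by (auto simp: card_2_iff)
    have "c p < 3" "c q < 3" "c r < 3" "c s < 3"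
      using edge(1)[OF e(1)] edge(1)[OF e(2)] less n by (auto simp: pq rs intro: less_le_trans)
    moreover have "c p \<noteq> c q" "c r \<noteq> c s"
      using neq e by (auto simp: pq rs)
    ultimately show ?thesis
      using two_or_three_colours_interleave[of "c p" "c q" "c r" "c s"] by (simp add: P_def pq rs)
  qed
  from independent_crossings_orient[of G P, OF indep this]
  obtain U where U: "\<And>e e'. edges_cross G e e' \<Longrightarrow>
    (e \<inter> U = {} \<and> e' \<subseteq> U \<and> P e e') \<or> (e' \<inter> U = {} \<and> e \<subseteq> U \<and> P e' e)"
    by blast
  define f where "f v = 2 * c v + (if v \<in> U then 1 else 0)" for v
  have f_less: "f v < 2 * n" if "v \<in> verts G" for v
    using less[OF that] unfolding f_def by auto
  have f_lower: "f ` e = (\<lambda>v. 2 * c v) ` e" if "e \<inter> U = {}" for e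
    using that by (intro image_cong) (auto simp: f_def)
  have f_upper: "f ` e = (\<lambda>v. 2 * c v + 1) ` e" if "e \<subseteq> U" for e
    using that by (intro image_cong) (auto simp: f_def)
  have "geometric_hom G (parabola_clique (2 * n)) f"
    unfolding geometric_hom_def
  proof (intro conjI allI impI)
    show "f ` verts G \<subseteq> verts (parabola_clique (2 * n))"
      using f_less by (auto simp: parabola_clique_def)
  next
    fix u v assume uv: "{u, v} \<in> edges G"
    have "f u \<noteq> f v"
      using neq[OF uv] unfolding f_def by (simp split: if_split)
    with edge(1)[OF uv] f_less show "{f u, f v} \<in> edges (parabola_clique (2 * n))"
      by (auto simp: parabola_clique_def)
  next
    fix e e' assume cross: "edges_cross G e e'"
    have "interleaved (f ` e) (f ` e')"
      using U[OF cross] f_lower f_upper by (metis P_def interleaved_commute)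
    moreover have "f ` e \<subseteq> {..<2 * n}" "f ` e' \<subseteq> {..<2 * n}"
      using cross edge(1) f_less unfolding edges_cross_def by blast+
    ultimately show "edges_cross (parabola_clique (2 * n)) (f ` e) (f ` e')"
      by (rule interleaved_chords_cross)
  qed
  then show ?thesis
    by blast
qed

theorem theorem6:
  fixes G :: "'a geom_graph"
  assumes "geometric_graph G"
    and "pairwise independent_crossings (crossings G)"
    and "chromatic_number G \<in> {2, 3}"
  shows "geochromatic_number G \<le> 2 * chromatic_number G"
proof -
  have "simple_graph G"
    using assms(1) unfolding geometric_graph_def by blast
  then obtain c where "proper_colouring G (chromatic_number G) c"
    by (rule proper_colouring_chromatic_number)
  then obtain f where "geometric_hom G (parabola_clique (2 * chromatic_number G)) f"
    using geometric_hom_of_colouring[OF assms(1,2)] assms(3) by fastforce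
  moreover have "0 < 2 * chromatic_number G"
    using assms(3) by auto
  ultimately show ?thesis
    unfolding geochromatic_number_def
    by (intro Least_le) (use geometric_clique_parabola_clique in blast)
qed

end
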